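(* Let $k\in\mathbb{Z}_+$, $n\ge 1$. The nonparametric maximum likelihood estimator of the hazard rates based on the sample $\mathbf{T}=(\mathbf{R},\mathbf{S},\mathbf{Y})$ of the first $n$ records and their associated near-records is $$\hat h_{j,k}=\frac{V_j^k}{1+\sum_{\ell=0}^k V_{j+\ell}^{k-\ell}}=\frac{V_j^k}{N_j^k},\qquad j=0,1,\ldots,R_n.$$ That is: for every realization $\mathbf{t}=(\mathbf{r},\mathbf{s},\mathbf{y})$ of the sample, the likelihood $\mathcal{L}(\mathbf{t}\mid\mathbf{h})$, regarded as a function of the hazard rates $(h_0,\ldots,h_{r_n})\in[0,1)^{r_n+1}$ (the likelihood does not depend on $h_j$ for $j>r_n$), is maximized at $h_j=v_j^k/n_j^k$, $j=0,\ldots,r_n$.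
   Context: $\mathbb{Z}_+=\{0,1,2,\ldots\}$. $X_1,X_2,\ldots$ are i.i.d. random variables with values in $\mathbb{Z}_+$ and infinite support. $P(i)=\mathbb{P}(X_1=i)$, $\overline F(i)=\mathbb{P}(X_1>i)$ (so $\overline F(i)=1$ for $i<0$), and the hazard rates are $h_j=P(j)/\overline F(j-1)\in[0,1)$, $\mathbf h=(h_0,h_1,\ldots)$. Thus $P(j)=h_j\prod_{i<j}(1-h_i)$ and $\overline F(j)=\prod_{i\le j}(1-h_i)$ for $j\ge 0$. Let $M_m=\max\{X_1,\ldots,X_m\}$; record times $L_1=1$, $L_m=\min\{i>L_{m-1}:X_i>X_{L_{m-1}}\}$; records $R_m=X_{L_m}$. Fix $k\in\mathbb{Z}_+$ and put $\delta=-k-1$. An observation $X_i$ ($i\ge2$) is a near-record (with parameter $k+1$) if $M_{i-1}-k\le X_i\le M_{i-1}$; it is associated with the record $R_m$ if $L_m<i<L_{m+1}$. The sample is $\mathbf T=(\mathbf R,\mathbf S,\mathbf Y)$, where $\mathbf R=(R_1,\ldots,R_n)$, $\mathbf S=(S_1,\ldots,S_n)$ with $S_i$ the number of near-records associated with $R_i$, and $\mathbf Y$ collects the values $Y_i^j$ ($1\le i\le n$, $1\le j\le S_i$), $Y_i^j$ being the value of the $j$-th near-record associated with $R_i$. A realization is $\mathbf t=(\mathbf r,\mathbf s,\mathbf y)$ with integers $0\le r_1<\cdots<r_n$, $s_i\in\mathbb{Z}_+$, and nonnegative integers $y_i^j\in\{r_i-k,\ldots,r_i\}$. Its likelihood (a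 known formula) is $$\mathcal L(\mathbf t\mid\mathbf h)=\overline F(r_n)\prod_{i=1}^n\frac{P(r_i)}{\overline F(r_i-k-1)^{s_i+1}}\prod_{j=1}^{s_i}P(y_i^j),$$ where $P$ and $\overline F$ are expressed through $\mathbf h$ by $P(j)=h_j\prod_{0\le i<j}(1-h_i)$ and $\overline F(j)=\prod_{0\le i\le j}(1-h_i)$ for $j\ge0$, and $\overline F(j)=1$ for $j<0$. For $m\in\mathbb{Z}_+$ and $\ell=0,\ldots,k$ define from $\mathbf t$: $a_m^0=\sum_{i=1}^n\big(\mathbf 1_{\{r_i=m\}}+\sum_{j=1}^{s_i}\mathbf 1_{\{r_i=m,\,y_i^j=m\}}\big)$; $a_m^\ell=\sum_{i=1}^n\sum_{j=1}^{s_i}\mathbf 1_{\{r_i=m+\ell,\,y_i^j=m\}}$ for $\ell\ge1$; $v_m^\ell=\sum_{j=0}^\ell a_m^j$; $n_m^\ell=1+\sum_{j=0}^\ell v_{m+j}^{\ell-j}$. Upper-case $V_m^\ell,N_m^\ell$ denote the corresponding random variables, computed from $\mathbf T$. *)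

theory Defs
  imports Complex_Main "HOL-Library.FuncSet"
begin

text \<open>
  A sample of \<open>n\<close> records and their near-records is given by functions \<open>r\<close>, \<open>s\<close>, \<open>y\<close>:
  \<open>r i\<close> is the value of the \<open>i\<close>-th record, \<open>s i\<close> the number of its near-records and \<open>y i j\<close> the
  value of the \<open>j\<close>-th one. Only the values at \<open>1 \<le> i \<le> n\<close> and \<open>1 \<le> j \<le> s i\<close> are meaningful.
\<close>

definition realization ::
  "nat \<Rightarrow> nat \<Rightarrow> (nat \<Rightarrow> nat) \<Rightarrow> (nat \<Rightarrow> nat) \<Rightarrow> (nat \<Rightarrow> nat \<Rightarrow> nat) \<Rightarrow> bool" where
  "realization k n r s y \<longleftrightarrow>
     strict_mono_on {1..n} r \<and>
     (\<forall>i\<in>{1..n}. \<forall>j\<in>{1..s i}. int (y i j) \<in> {int (r i) - int k..int (r i)})"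

definition prob_mass :: "(nat \<Rightarrow> real) \<Rightarrow> nat \<Rightarrow> real" where
  "prob_mass h j = h j * (\<Prod>i<j. 1 - h i)"

text \<open>The argument of the survival function is an integer, since \<open>r i - k - 1\<close> may be negative.\<close>

definition survival :: "(nat \<Rightarrow> real) \<Rightarrow> int \<Rightarrow> real" where
  "survival h j = (if j < 0 then 1 else (\<Prod>i\<le>nat j. 1 - h i))"

definition likelihood ::
  "nat \<Rightarrow> nat \<Rightarrow> (nat \<Rightarrow> nat) \<Rightarrow> (nat \<Rightarrow> nat) \<Rightarrow> (nat \<Rightarrow> nat \<Rightarrow> nat) \<Rightarrow> (nat \<Rightarrow> real) \<Rightarrow> real" where
  "likelihood k n r s y h =
     survival h (int (r n)) *
     (\<Prod>i=1..n. prob_mass h (r i) / survival h (int (r i) - int k - 1) ^ (s i + 1) *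
                (\<Prod>j=1..s i. prob_mass h (y i j)))"

text \<open>
  In \<open>a_stat\<close>, \<open>v_stat\<close> and \<open>n_stat\<close> the last two arguments \<open>l\<close>, \<open>m\<close> are the superscript and
  the subscript of $a_m^l$, $v_m^l$ and $n_m^l$, in this order.
\<close>

definition a_stat ::
  "nat \<Rightarrow> (nat \<Rightarrow> nat) \<Rightarrow> (nat \<Rightarrow> nat) \<Rightarrow> (nat \<Rightarrow> nat \<Rightarrow> nat) \<Rightarrow> nat \<Rightarrow> nat \<Rightarrow> nat" where
  "a_stat n r s y l m =
     (if l = 0
      then (\<Sum>i=1..n. of_bool (r i = m) + (\<Sum>j=1..s i. of_bool (r i = m \<and> y i j = m)))
      else (\<Sum>i=1..n. \<Sum>j=1..s i. of_bool (r i = m + l \<and> y i j = m)))"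

definition v_stat ::
  "nat \<Rightarrow> (nat \<Rightarrow> nat) \<Rightarrow> (nat \<Rightarrow> nat) \<Rightarrow> (nat \<Rightarrow> nat \<Rightarrow> nat) \<Rightarrow> nat \<Rightarrow> nat \<Rightarrow> nat" where
  "v_stat n r s y l m = (\<Sum>j=0..l. a_stat n r s y j m)"

definition n_stat ::
  "nat \<Rightarrow> (nat \<Rightarrow> nat) \<Rightarrow> (nat \<Rightarrow> nat) \<Rightarrow> (nat \<Rightarrow> nat \<Rightarrow> nat) \<Rightarrow> nat \<Rightarrow> nat \<Rightarrow> nat" where
  "n_stat n r s y l m = 1 + (\<Sum>j=0..l. v_stat n r s y (l - j) (m + j))"

definition hazard_estimate ::
  "nat \<Rightarrow> nat \<Rightarrow> (nat \<Rightarrow> nat) \<Rightarrow> (nat \<Rightarrow> nat) \<Rightarrow> (nat \<Rightarrow> nat \<Rightarrow> nat) \<Rightarrow> nat \<Rightarrow> real" where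
  "hazard_estimate k n r s y j = real (v_stat n r s y k j) / real (n_stat n r s y k j)"

end

(* A value x attached to a record q contributes the factor P(x) / F(q - k - 1) to the likelihood,
   which is h_x times the product of 1 - h_m over q - k <= m < x. Hence the likelihood is the
   product over m <= r_n of h_m ^ v_m^k * (1 - h_m) ^ (n_m^k - v_m^k), and each factor is
   maximised separately at h_m = v_m^k / n_m^k. *)

theory Submission
  imports Defs
begin

text \<open>With p = v / c this is the tangent bound t \<le> exp (t - 1) at t = x / p, raised to the
  power v. Equality holds at x = p, which is what makes the bound sharp enough to locate a
  maximum.\<close>

lemma power_le_exp_tangent:
  fixes x c :: real
  assumes "0 \<le> x" "c > 0"
  shows "x ^ v \<le> (real v / c) ^ v * exp (c * x - real v)"
proof (cases "v = 0")
  case True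
  then show ?thesis using assms by simp
next
  case False
  define p where "p = real v / c"
  have p: "p > 0" using False assms by (simp add: p_def)
  have "x / p \<le> exp (x / p - 1)"
    using exp_ge_add_one_self[of "x / p - 1"] by simp
  then have "(x / p) ^ v \<le> exp (x / p - 1) ^ v"
    using assms p by (intro power_mono) auto
  also have "\<dots> = exp (real v * (x / p - 1))"
    by (simp add: exp_of_nat_mult)
  also have "real v * (x / p - 1) = c * x - real v"
    using False assms by (simp add: p_def field_simps)
  finally show ?thesis
    using p by (simp add: p_def[symmetric] power_divide divide_le_eq mult.commute)
qed

text \<open>The tangent bound is applied to x with exponent v and to 1 - x with exponent w, both
  with c = v + w. The exponents c x - v and c (1 - x) - w add up to 0, so the exponentials cancel.
  Avoiding logarithms and derivatives lets x, v or w be 0.\<close>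

lemma bernoulli_likelihood_le:
  fixes x :: real
  assumes "0 \<le> x" "x \<le> 1" "v + w > 0"
  defines "p \<equiv> real v / real (v + w)"
  shows "x ^ v * (1 - x) ^ w \<le> p ^ v * (1 - p) ^ w"
proof -
  let ?c = "real (v + w)"
  have c: "?c > 0" using assms(3) by linarith
  have q: "1 - p = real w / ?c" using c by (simp add: p_def field_simps)
  have "x ^ v * (1 - x) ^ w
      \<le> (p ^ v * exp (?c * x - real v)) * ((1 - p) ^ w * exp (?c * (1 - x) - real w))"
    unfolding q unfolding p_def using assms c
    by (intro mult_mono power_le_exp_tangent) auto
  also have "\<dots> = p ^ v * (1 - p) ^ w * exp ((?c * x - real v) + (?c * (1 - x) - real w))"
    unfolding exp_add by (simp only: mult_ac)
  also have "(?c * x - real v) + (?c * (1 - x) - real w) = 0"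
    by (simp add: algebra_simps)
  finally show ?thesis by simp
qed

text \<open>Only q = x - m can contribute. This collapses the sums over superscripts;
  \<open>Q\<close> carries the rest of the indicator.\<close>

lemma sum_of_bool_shift:
  fixes l m x :: nat
  shows "(\<Sum>q=0..l. of_bool (x = m + q \<and> Q q)) = (of_bool (m \<le> x \<and> x \<le> m + l \<and> Q (x - m)) :: nat)"
proof (induction l)
  case 0
  then show ?case by auto
next
  case (Suc l)
  show ?case
    unfolding sum.atLeast0_atMost_Suc Suc by (cases "x = m + Suc l") auto
qed

text \<open>Folding the case l = 0 into an indicator lets the sum over l be exchanged with the sums
  over records and near-records.\<close>

lemma a_stat_eq:
  "a_stat n r s y l m =
     (\<Sum>i=1..n. of_bool (r i = m + l \<and> l = 0) + (\<Sum>j=1..s i. of_bool (r i = m + l \<and> y i j = m)))"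
  by (simp add: a_stat_def)

lemma v_stat_eq:
  "v_stat n r s y l m =
     (\<Sum>i=1..n. of_bool (r i = m) + (\<Sum>j=1..s i. of_bool (y i j = m \<and> m \<le> r i \<and> r i \<le> m + l)))"
proof -
  have "v_stat n r s y l m =
      (\<Sum>i=1..n. (\<Sum>q=0..l. of_bool (r i = m + q \<and> q = 0)) +
                 (\<Sum>j=1..s i. \<Sum>q=0..l. of_bool (r i = m + q \<and> y i j = m)))"
    unfolding v_stat_def a_stat_eq
    by (subst sum.swap, simp only: sum.distrib, subst sum.swap[of _ "{0..l}"]) (rule refl)
  also have "\<dots> = (\<Sum>i=1..n. of_bool (r i = m) +
                 (\<Sum>j=1..s i. of_bool (y i j = m \<and> m \<le> r i \<and> r i \<le> m + l)))"
    unfolding sum_of_bool_shift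
    by (intro sum.cong refl arg_cong2[where f = "(+)"] arg_cong[where f = of_bool]) auto
  finally show ?thesis .
qed

lemma n_stat_eq:
  "n_stat n r s y l m = 1 +
     (\<Sum>i=1..n. of_bool (m \<le> r i \<and> r i \<le> m + l) +
                (\<Sum>j=1..s i. of_bool (m \<le> y i j \<and> y i j \<le> r i \<and> r i \<le> m + l)))"
proof -
  \<comment> \<open>Since (m + q) + (l - q) = m + l, the upper bound on \<open>r i\<close> does not
    depend on q. The conjunct \<open>True\<close> brings the indicator into the shape of
    \<open>sum_of_bool_shift\<close>.\<close>
  have "n_stat n r s y l m = 1 + (\<Sum>q=0..l. \<Sum>i=1..n. of_bool (r i = m + q \<and> True) +
          (\<Sum>j=1..s i. of_bool (y i j = m + q \<and> m + q \<le> r i \<and> r i \<le> m + l)))"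
    unfolding n_stat_def v_stat_eq by (intro arg_cong[where f = "\<lambda>x. 1 + x"] sum.cong refl) auto
  also have "\<dots> = 1 + (\<Sum>i=1..n. (\<Sum>q=0..l. of_bool (r i = m + q \<and> True)) +
          (\<Sum>j=1..s i. \<Sum>q=0..l. of_bool (y i j = m + q \<and> m + q \<le> r i \<and> r i \<le> m + l)))"
    by (subst sum.swap, simp only: sum.distrib, subst sum.swap[of _ "{0..l}"]) (rule refl)
  also have "\<dots> = 1 + (\<Sum>i=1..n. of_bool (m \<le> r i \<and> r i \<le> m + l) +
          (\<Sum>j=1..s i. of_bool (m \<le> y i j \<and> y i j \<le> r i \<and> r i \<le> m + l)))"
    unfolding sum_of_bool_shift
    by (intro sum.cong refl arg_cong2[where f = "(+)"] arg_cong[where f = of_bool]) auto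
  finally show ?thesis .
qed

lemma realization_record_le:
  assumes "realization k n r s y" "i \<in> {1..n}"
  shows "r i \<le> r n"
proof -
  from assms have "strict_mono_on {1..n} r" by (simp add: realization_def)
  then show ?thesis
    using assms(2) by (auto intro: strict_mono_on_leD[of "{1..n}" r])
qed

lemma realization_near_record:
  assumes "realization k n r s y" "i \<in> {1..n}" "j \<in> {1..s i}"
  shows "y i j \<le> r i" "r i \<le> y i j + k"
proof -
  have "int (y i j) \<in> {int (r i) - int k..int (r i)}"
    using assms unfolding realization_def by blast
  then show "y i j \<le> r i" "r i \<le> y i j + k" by auto
qed

text \<open>The exponent of 1 - h_m in the likelihood. The leading 1 comes from the survival factor
  at r_n; the condition r_i - k \<le> m is written additively to avoid truncated
  subtraction.\<close>

definition w_stat ::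
  "nat \<Rightarrow> (nat \<Rightarrow> nat) \<Rightarrow> (nat \<Rightarrow> nat) \<Rightarrow> (nat \<Rightarrow> nat \<Rightarrow> nat) \<Rightarrow> nat \<Rightarrow> nat \<Rightarrow> nat" where
  "w_stat n r s y k m = 1 +
     (\<Sum>i=1..n. of_bool (r i \<le> m + k \<and> m < r i) +
                (\<Sum>j=1..s i. of_bool (r i \<le> m + k \<and> m < y i j)))"

text \<open>A near-record lies within k below its record, so the window conditions in
  \<open>v_stat_eq\<close> hold automatically.\<close>

lemma v_stat_realization:
  assumes "realization k n r s y"
  shows "v_stat n r s y k m =
     (\<Sum>i=1..n. of_bool (m = r i) + (\<Sum>j=1..s i. of_bool (m = y i j)))"
  unfolding v_stat_eq using realization_near_record[OF assms]
  by (intro sum.cong refl arg_cong2[where f = "(+)"] arg_cong[where f = of_bool]) auto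

text \<open>Each indicator of m \<le> x in \<open>n_stat_eq\<close>, for x a record or near-record,
  splits into m = x, counted by \<open>v_stat\<close>, and m < x, counted by
  \<open>w_stat\<close>.\<close>

lemma n_stat_realization:
  assumes "realization k n r s y"
  shows "n_stat n r s y k m = v_stat n r s y k m + w_stat n r s y k m"
proof -
  have "v_stat n r s y k m + w_stat n r s y k m = 1 +
     (\<Sum>i=1..n. (of_bool (m = r i) + of_bool (r i \<le> m + k \<and> m < r i)) +
       (\<Sum>j=1..s i. of_bool (m = y i j) + of_bool (r i \<le> m + k \<and> m < y i j)))"
    unfolding v_stat_realization[OF assms] w_stat_def by (simp add: sum.distrib)
  also have "\<dots> = n_stat n r s y k m"
    unfolding n_stat_eq using realization_near_record[OF assms]
    by (intro sum.cong refl arg_cong2[where f = "(+)"]) auto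
  finally show ?thesis ..
qed

text \<open>As q - k \<le> x, the denominator cancels the initial factors of P(x); they are nonzero
  because h < 1. Indicator exponents stretch what remains to the common range m \<le> b, so that
  such products can later be multiplied coordinate by coordinate.\<close>

lemma prob_mass_div_survival:
  assumes "\<And>m. m \<le> b \<Longrightarrow> h m < 1" "x \<le> q" "q \<le> x + k" "q \<le> b"
  shows "prob_mass h x / survival h (int q - int k - 1) =
     (\<Prod>m\<le>b. h m ^ of_bool (m = x) * (1 - h m) ^ of_bool (q \<le> m + k \<and> m < x))"
proof -
  \<comment> \<open>For q \<le> k the integer argument is negative and the survival function is 1,
    which agrees with the empty product given by truncated subtraction.\<close>
  have surv: "survival h (int q - int k - 1) = (\<Prod>m<q - k. 1 - h m)"
  proof (cases "q \<le> k")
    case False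
    then have "{..nat (int q - int k - 1)} = {..<q - k}" by auto
    with False show ?thesis by (simp add: survival_def)
  qed (simp add: survival_def)
  have nz: "(\<Prod>m<q - k. 1 - h m) \<noteq> 0"
  proof -
    have "h m < 1" if "m < q - k" for m
      using that assms(4) by (intro assms(1)) linarith
    then show ?thesis by fastforce
  qed
  have "{..<x} = {..<q - k} \<union> {q - k..<x}" using assms by auto
  then have split: "(\<Prod>m<x. 1 - h m) = (\<Prod>m<q - k. 1 - h m) * (\<Prod>m=q - k..<x. 1 - h m)"
    by (simp add: prod.union_disjoint ivl_disj_int)
  have hx: "(\<Prod>m\<le>b. h m ^ of_bool (m = x)) = h x"
  proof -
    have "(\<Prod>m\<le>b. h m ^ of_bool (m = x)) = (\<Prod>m\<le>b. if m = x then h m else 1)"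
      by (intro prod.cong) auto
    then show ?thesis using assms by simp
  qed
  have "{q - k..<x} = {m \<in> {..b}. q \<le> m + k \<and> m < x}" using assms by auto
  then have "(\<Prod>m=q - k..<x. 1 - h m) = (\<Prod>m\<le>b. if q \<le> m + k \<and> m < x then 1 - h m else 1)"
    by (simp only: prod.inter_filter[OF finite_atMost])
  also have "\<dots> = (\<Prod>m\<le>b. (1 - h m) ^ of_bool (q \<le> m + k \<and> m < x))"
    by (intro prod.cong) auto
  finally show ?thesis
    using nz by (simp add: surv prob_mass_def split prod.distrib hx)
qed

lemma likelihood_factorization:
  assumes real: "realization k n r s y" and h: "\<And>m. m \<le> r n \<Longrightarrow> h m < 1"
  shows "likelihood k n r s y h =
     (\<Prod>m\<le>r n. h m ^ v_stat n r s y k m * (1 - h m) ^ w_stat n r s y k m)"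
proof -
  let ?b = "r n"
  \<comment> \<open>\<open>G q x m\<close> is the share of coordinate m in the contribution of a
    value x attached to the record q.\<close>
  define G where "G q x m = h m ^ of_bool (m = x) * (1 - h m) ^ of_bool (q \<le> m + k \<and> m < x)"
    for q x m
  have factor: "prob_mass h x / survival h (int (r i) - int k - 1) = (\<Prod>m\<le>?b. G (r i) x m)"
    if "i \<in> {1..n}" "x \<le> r i" "r i \<le> x + k" for i x
    unfolding G_def using h that realization_record_le[OF real]
    by (intro prob_mass_div_survival) auto
  have record_factor: "prob_mass h (r i) / survival h (int (r i) - int k - 1) ^ (s i + 1) *
        (\<Prod>j=1..s i. prob_mass h (y i j)) =
      (\<Prod>m\<le>?b. G (r i) (r i) m * (\<Prod>j=1..s i. G (r i) (y i j) m))"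
    if i: "i \<in> {1..n}" for i
  proof -
    let ?F = "survival h (int (r i) - int k - 1)"
    \<comment> \<open>The s_i + 1 survival factors are dealt out, one to the record and one to each
      of its near-records.\<close>
    have "prob_mass h (r i) / ?F ^ (s i + 1) * (\<Prod>j=1..s i. prob_mass h (y i j)) =
        prob_mass h (r i) / ?F * (\<Prod>j=1..s i. prob_mass h (y i j) / ?F)"
      by (simp add: prod_dividef)
    also have "(\<Prod>j=1..s i. prob_mass h (y i j) / ?F) =
        (\<Prod>j=1..s i. \<Prod>m\<le>?b. G (r i) (y i j) m)"
      using i realization_near_record[OF real i] by (intro prod.cong refl factor) auto
    also have "\<dots> = (\<Prod>m\<le>?b. \<Prod>j=1..s i. G (r i) (y i j) m)"
      by (rule prod.swap)
    finally show ?thesis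
      using factor[OF i, of "r i"] by (simp add: prod.distrib)
  qed
  have "likelihood k n r s y h =
      (\<Prod>m\<le>?b. 1 - h m) *
      (\<Prod>i=1..n. \<Prod>m\<le>?b. G (r i) (r i) m * (\<Prod>j=1..s i. G (r i) (y i j) m))"
    unfolding likelihood_def using record_factor by (simp add: survival_def)
  also have "\<dots> = (\<Prod>m\<le>?b. (1 - h m) *
      (\<Prod>i=1..n. G (r i) (r i) m * (\<Prod>j=1..s i. G (r i) (y i j) m)))"
    by (subst prod.swap) (simp add: prod.distrib)
  \<comment> \<open>Products of powers become powers of sums; the separate factor 1 - h_m accounts
    for the leading 1 in \<open>w_stat\<close>.\<close>
  also have "\<dots> = (\<Prod>m\<le>?b. h m ^ v_stat n r s y k m * (1 - h m) ^ w_stat n r s y k m)"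
    unfolding v_stat_realization[OF real] w_stat_def G_def
    by (simp only: power_add power_sum prod.distrib power_one_right mult_ac)
  finally show ?thesis .
qed

text \<open>Records and near-records are at most r_n, so h is evaluated only up to r_n. Besides
  giving the first claim of the theorem, this allows the estimate to be replaced by its
  restriction.\<close>

lemma likelihood_cong:
  assumes real: "realization k n r s y" and eq: "\<And>m. m \<le> r n \<Longrightarrow> h m = h' m"
  shows "likelihood k n r s y h = likelihood k n r s y h'"
proof -
  have pm: "prob_mass h x = prob_mass h' x" if "x \<le> r n" for x
    unfolding prob_mass_def using eq that by (intro arg_cong2[where f = "(*)"] prod.cong) auto
  have sv: "survival h x = survival h' x" if "x \<le> int (r n)" for x
    unfolding survival_def using eq that by (auto intro!: prod.cong)
  have le: "r i \<le> r n" "j \<in> {1..s i} \<Longrightarrow> y i j \<le> r n" if "i \<in> {1..n}" for i j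
    using realization_record_le[OF real that] realization_near_record(1)[OF real that, of j]
    by auto
  show ?thesis
    unfolding likelihood_def using le
    by (intro arg_cong2[where f = "(*)"] prod.cong refl arg_cong2[where f = "(/)"]
        arg_cong2[where f = "(^)"] pm sv) force+
qed

theorem proposition3p1:
  fixes k n :: nat
    and r s :: "nat \<Rightarrow> nat"
    and y :: "nat \<Rightarrow> nat \<Rightarrow> nat"
  assumes "n \<ge> 1"
    and "realization k n r s y"
  shows "(\<forall>h h'. (\<forall>j\<le>r n. h j = h' j) \<longrightarrow> likelihood k n r s y h = likelihood k n r s y h') \<and>
         is_arg_max (likelihood k n r s y) (\<lambda>h. h \<in> {0..r n} \<rightarrow>\<^sub>E {0..<1})
           (restrict (hazard_estimate k n r s y) {0..r n})"
proof -
  let ?L = "likelihood k n r s y" and ?p = "hazard_estimate k n r s y"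
    and ?v = "v_stat n r s y k" and ?w = "w_stat n r s y k"
  have w: "?w m > 0" for m by (simp add: w_stat_def)
  have p: "?p m = real (?v m) / real (?v m + ?w m)" for m
    by (simp add: hazard_estimate_def n_stat_realization[OF assms(2)])
  \<comment> \<open>Positivity of \<open>?w m\<close> keeps the estimate strictly below 1, hence
    admissible.\<close>
  have p_range: "?p m \<in> {0..<1}" for m
    unfolding p using w[of m] by simp
  have max: "?L h \<le> ?L (restrict ?p {0..r n})" if h: "h \<in> {0..r n} \<rightarrow>\<^sub>E {0..<1}" for h
  proof -
    have h: "0 \<le> h m" "h m < 1" if "m \<le> r n" for m
      using PiE_mem[OF h, of m] that by auto
    have "?L h = (\<Prod>m\<le>r n. h m ^ ?v m * (1 - h m) ^ ?w m)"
      using h by (intro likelihood_factorization[OF assms(2)])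
    also have "\<dots> \<le> (\<Prod>m\<le>r n. ?p m ^ ?v m * (1 - ?p m) ^ ?w m)"
    proof (intro prod_mono conjI)
      fix m assume "m \<in> {..r n}"
      then have "0 \<le> h m" "h m < 1" using h by auto
      then show "0 \<le> h m ^ ?v m * (1 - h m) ^ ?w m" by simp
      show "h m ^ ?v m * (1 - h m) ^ ?w m \<le> ?p m ^ ?v m * (1 - ?p m) ^ ?w m"
        unfolding p using \<open>0 \<le> h m\<close> \<open>h m < 1\<close> w[of m]
        by (intro bernoulli_likelihood_le) auto
    qed
    also have "\<dots> = ?L ?p"
      using p_range by (intro likelihood_factorization[OF assms(2), symmetric]) auto
    \<comment> \<open>The restriction is \<open>undefined\<close> beyond r_n, where the likelihood
      does not look.\<close>
    also have "\<dots> = ?L (restrict ?p {0..r n})"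
      by (rule likelihood_cong[OF assms(2)]) simp
    finally show ?thesis .
  qed
  have "is_arg_max ?L (\<lambda>h. h \<in> {0..r n} \<rightarrow>\<^sub>E {0..<1}) (restrict ?p {0..r n})"
    unfolding is_arg_max_def using p_range max by (auto simp flip: not_le)
  then show ?thesis using likelihood_cong[OF assms(2)] by blast
qed

end
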